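(* Let $(\mathcal C,\otimes,\mathbf I,c)$ be a symmetric strict monoidal category, let $(C,A;\sigma_{C,C},\sigma_{A,A},\sigma_{C,A})$ be a rank $2$ braided system in $\mathcal C$, and let $\pi\colon C\to A$ be a morphism in $\mathcal C$. Suppose that for some non-negative integers $\alpha_1,\alpha_2,\gamma_1,\gamma_2$ the following equality of morphisms $C\otimes C\otimes C\to A\otimes A\otimes A$ holds: $$(A\otimes\sigma_{A,A}^{\alpha_1})\circ(c_{A,A}\otimes\pi)\circ(\pi\otimes\sigma_{C,A})\circ(c_{C,C}\otimes\pi)\circ(C\otimes\sigma_{C,C}^{\gamma_1})$$ $$=(A\otimes\sigma_{A,A}^{\alpha_2})\circ(A\otimes\pi\otimes A)\circ(c_{C,A}\otimes\pi)\circ(C\otimes\pi\otimes C)\circ(C\otimes\sigma_{C,C}^{\gamma_2}).$$ Then any Yetter-Drinfel'd modules $(M_i,\rho_i,\delta_i)$, $1\le i\le r$, over $(C,A;\sigma_{C,C},\sigma_{A,A},\sigma_{C,A})$ form a braided system in $\mathcal C$, with the braiding on $M_i\otimes M_j$ defined by $$\sigma_{gYD}=(M_j\otimes\rho_i)\circ(c_{M_i,M_j}\otimes\pi)\circ(M_i\otimes\delta_j).$$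
   Context: In a strict monoidal category, an object's name also denotes its identity morphism, and $\sigma^{n}$ is the $n$-fold composite ($\sigma^0=\mathrm{Id}$). Braidings are not assumed invertible. A rank $r$ braided system is a family of objects $V_1,\dots,V_r$ with morphisms $\sigma_{i,j}\colon V_i\otimes V_j\to V_j\otimes V_i$, $1\le i\le j\le r$, satisfying, for all $1\le i\le j\le k\le r$, the colored Yang-Baxter equation $$(\sigma_{j,k}\otimes V_i)\circ(V_j\otimes\sigma_{i,k})\circ(\sigma_{i,j}\otimes V_k)=(V_k\otimes\sigma_{i,j})\circ(\sigma_{i,k}\otimes V_j)\circ(V_i\otimes\sigma_{j,k}).$$ A rank $2$ system is written $(C,A;\sigma_{C,C},\sigma_{A,A},\sigma_{C,A})$, with $V_1=C$, $V_2=A$. A Yetter-Drinfel'd (YD) module over $(C,A;\sigma_{C,C},\sigma_{A,A},\sigma_{C,A})$ is an object $M$ with morphisms $\rho\colon M\otimes A\to M$ and $\delta\colon M\to M\otimes C$ such that $\rho\circ(\rho\otimes A)=\rho\circ(\rho\otimes A)\circ(M\otimes\sigma_{A,A})$ (braided module), $(\delta\otimes C)\circ\delta=(M\otimes\sigma_{C,C})\circ(\delta\otimes C)\circ\delta$ (braided comodule), and $\delta\circ\rho=(\rho\otimes C)\circ(M\otimes\sigma_{C,A})\circ(\delta\otimes A)$. *)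

theory Defs
  imports Main
begin

record ('o, 'm) monoidal_structure =
  Obj :: "'o set"
  Arr :: "'m set"
  Dom :: "'m \<Rightarrow> 'o"
  Cod :: "'m \<Rightarrow> 'o"
  Id :: "'o \<Rightarrow> 'm" ("\<one>\<index>")
  Comp :: "'m \<Rightarrow> 'm \<Rightarrow> 'm" (infixr "\<cdot>\<index>" 60)
  TensorObj :: "'o \<Rightarrow> 'o \<Rightarrow> 'o" (infixl "\<odot>\<index>" 70)
  TensorArr :: "'m \<Rightarrow> 'm \<Rightarrow> 'm" (infixl "\<otimes>\<index>" 70)
  Unit :: "'o" ("\<I>\<index>")

definition hom :: "('o, 'm, 'z) monoidal_structure_scheme \<Rightarrow> 'o \<Rightarrow> 'o \<Rightarrow> 'm set" where
  "hom \<C> X Y = {f \<in> Arr \<C>. Dom \<C> f = X \<and> Cod \<C> f = Y}"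

text \<open>\<open>g \<cdot> f\<close> is the composite "first \<open>f\<close>, then \<open>g\<close>". All operations are total
  functions, constrained only on objects, arrows and composable pairs.\<close>

locale category =
  fixes \<C> :: "('o, 'm, 'z) monoidal_structure_scheme" (structure)
  assumes dom_closed: "f \<in> Arr \<C> \<Longrightarrow> Dom \<C> f \<in> Obj \<C>"
    and cod_closed: "f \<in> Arr \<C> \<Longrightarrow> Cod \<C> f \<in> Obj \<C>"
    and id_hom: "X \<in> Obj \<C> \<Longrightarrow> \<one> X \<in> hom \<C> X X"
    and comp_hom: "\<lbrakk>f \<in> hom \<C> X Y; g \<in> hom \<C> Y Z\<rbrakk> \<Longrightarrow> g \<cdot> f \<in> hom \<C> X Z"
    and comp_id_left: "f \<in> hom \<C> X Y \<Longrightarrow> \<one> Y \<cdot> f = f"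
    and comp_id_right: "f \<in> hom \<C> X Y \<Longrightarrow> f \<cdot> \<one> X = f"
    and comp_assoc: "\<lbrakk>f \<in> hom \<C> W X; g \<in> hom \<C> X Y; h \<in> hom \<C> Y Z\<rbrakk>
      \<Longrightarrow> (h \<cdot> g) \<cdot> f = h \<cdot> (g \<cdot> f)"

locale strict_monoidal_category = category \<C>
  for \<C> :: "('o, 'm, 'z) monoidal_structure_scheme" (structure) +
  assumes unit_obj: "\<I> \<in> Obj \<C>"
    and tensor_obj: "\<lbrakk>X \<in> Obj \<C>; Y \<in> Obj \<C>\<rbrakk> \<Longrightarrow> X \<odot> Y \<in> Obj \<C>"
    and tensor_hom: "\<lbrakk>f \<in> hom \<C> X Y; g \<in> hom \<C> Z W\<rbrakk> \<Longrightarrow> f \<otimes> g \<in> hom \<C> (X \<odot> Z) (Y \<odot> W)"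
    and tensor_id: "\<lbrakk>X \<in> Obj \<C>; Y \<in> Obj \<C>\<rbrakk> \<Longrightarrow> \<one> X \<otimes> \<one> Y = \<one> (X \<odot> Y)"
    and interchange: "\<lbrakk>f \<in> hom \<C> X Y; f' \<in> hom \<C> Y Z; g \<in> hom \<C> U V; g' \<in> hom \<C> V W\<rbrakk>
      \<Longrightarrow> (f' \<cdot> f) \<otimes> (g' \<cdot> g) = (f' \<otimes> g') \<cdot> (f \<otimes> g)"
    and tensor_obj_assoc: "\<lbrakk>X \<in> Obj \<C>; Y \<in> Obj \<C>; Z \<in> Obj \<C>\<rbrakk>
      \<Longrightarrow> (X \<odot> Y) \<odot> Z = X \<odot> (Y \<odot> Z)"
    and tensor_arr_assoc: "\<lbrakk>f \<in> Arr \<C>; g \<in> Arr \<C>; h \<in> Arr \<C>\<rbrakk>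
      \<Longrightarrow> (f \<otimes> g) \<otimes> h = f \<otimes> (g \<otimes> h)"
    and unit_obj_left: "X \<in> Obj \<C> \<Longrightarrow> \<I> \<odot> X = X"
    and unit_obj_right: "X \<in> Obj \<C> \<Longrightarrow> X \<odot> \<I> = X"
    and unit_arr_left: "f \<in> Arr \<C> \<Longrightarrow> \<one> \<I> \<otimes> f = f"
    and unit_arr_right: "f \<in> Arr \<C> \<Longrightarrow> f \<otimes> \<one> \<I> = f"

locale symmetric_strict_monoidal_category = strict_monoidal_category \<C>
  for \<C> :: "('o, 'm, 'z) monoidal_structure_scheme" (structure) +
  fixes c :: "'o \<Rightarrow> 'o \<Rightarrow> 'm"
  assumes sym_hom: "\<lbrakk>X \<in> Obj \<C>; Y \<in> Obj \<C>\<rbrakk> \<Longrightarrow> c X Y \<in> hom \<C> (X \<odot> Y) (Y \<odot> X)"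
    and sym_natural: "\<lbrakk>f \<in> hom \<C> X X'; g \<in> hom \<C> Y Y'\<rbrakk>
      \<Longrightarrow> c X' Y' \<cdot> (f \<otimes> g) = (g \<otimes> f) \<cdot> c X Y"
    and sym_hexagon_right: "\<lbrakk>X \<in> Obj \<C>; Y \<in> Obj \<C>; Z \<in> Obj \<C>\<rbrakk>
      \<Longrightarrow> c X (Y \<odot> Z) = (\<one> Y \<otimes> c X Z) \<cdot> (c X Y \<otimes> \<one> Z)"
    and sym_hexagon_left: "\<lbrakk>X \<in> Obj \<C>; Y \<in> Obj \<C>; Z \<in> Obj \<C>\<rbrakk>
      \<Longrightarrow> c (X \<odot> Y) Z = (c X Z \<otimes> \<one> Y) \<cdot> (\<one> X \<otimes> c Y Z)"
    and sym_involutive: "\<lbrakk>X \<in> Obj \<C>; Y \<in> Obj \<C>\<rbrakk> \<Longrightarrow> c Y X \<cdot> c X Y = \<one> (X \<odot> Y)"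

context
  fixes \<C> :: "('o, 'm, 'z) monoidal_structure_scheme" (structure)
begin

primrec endo_power :: "'m \<Rightarrow> nat \<Rightarrow> 'm" where
  "endo_power f 0 = \<one> (Dom \<C> f)"
| "endo_power f (Suc n) = f \<cdot> endo_power f n"

text \<open>Only the components \<open>\<sigma> i j\<close> with \<open>1 \<le> i \<le> j \<le> r\<close> are constrained, and they need not be
  invertible.\<close>

definition braided_system ::
    "nat \<Rightarrow> (nat \<Rightarrow> 'o) \<Rightarrow> (nat \<Rightarrow> nat \<Rightarrow> 'm) \<Rightarrow> bool" where
  "braided_system r V \<sigma> \<longleftrightarrow>
     (\<forall>i. 1 \<le> i \<and> i \<le> r \<longrightarrow> V i \<in> Obj \<C>) \<and>
     (\<forall>i j. 1 \<le> i \<and> i \<le> j \<and> j \<le> r \<longrightarrow> \<sigma> i j \<in> hom \<C> (V i \<odot> V j) (V j \<odot> V i)) \<and>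
     (\<forall>i j k. 1 \<le> i \<and> i \<le> j \<and> j \<le> k \<and> k \<le> r \<longrightarrow>
        (\<sigma> j k \<otimes> \<one> (V i)) \<cdot> (\<one> (V j) \<otimes> \<sigma> i k) \<cdot> (\<sigma> i j \<otimes> \<one> (V k)) =
        (\<one> (V k) \<otimes> \<sigma> i j) \<cdot> (\<sigma> i k \<otimes> \<one> (V j)) \<cdot> (\<one> (V i) \<otimes> \<sigma> j k))"

text \<open>A rank 2 system \<open>(C, A; \<sigma>CC, \<sigma>AA, \<sigma>CA)\<close>, with \<open>V 1 = C\<close> and \<open>V 2 = A\<close>. The value of the
  second function at \<open>i = 2\<close>, \<open>j = 1\<close> is irrelevant.\<close>

definition braided_system2 ::
    "'o \<Rightarrow> 'o \<Rightarrow> 'm \<Rightarrow> 'm \<Rightarrow> 'm \<Rightarrow> bool" where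
  "braided_system2 C A \<sigma>CC \<sigma>AA \<sigma>CA \<longleftrightarrow>
     braided_system 2 (\<lambda>i. if i = 1 then C else A)
       (\<lambda>i j. if j = 1 then \<sigma>CC else if i = 1 then \<sigma>CA else \<sigma>AA)"

definition braided_module ::
    "'o \<Rightarrow> 'm \<Rightarrow> 'o \<Rightarrow> 'm \<Rightarrow> bool" where
  "braided_module A \<sigma>AA M \<rho> \<longleftrightarrow>
     M \<in> Obj \<C> \<and> \<rho> \<in> hom \<C> (M \<odot> A) M \<and>
     \<rho> \<cdot> (\<rho> \<otimes> \<one> A) = \<rho> \<cdot> (\<rho> \<otimes> \<one> A) \<cdot> (\<one> M \<otimes> \<sigma>AA)"

definition braided_comodule ::
    "'o \<Rightarrow> 'm \<Rightarrow> 'o \<Rightarrow> 'm \<Rightarrow> bool" where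
  "braided_comodule C \<sigma>CC M \<delta> \<longleftrightarrow>
     M \<in> Obj \<C> \<and> \<delta> \<in> hom \<C> M (M \<odot> C) \<and>
     (\<delta> \<otimes> \<one> C) \<cdot> \<delta> = (\<one> M \<otimes> \<sigma>CC) \<cdot> (\<delta> \<otimes> \<one> C) \<cdot> \<delta>"

definition yetter_drinfeld_module ::
    "'o \<Rightarrow> 'o \<Rightarrow> 'm \<Rightarrow> 'm \<Rightarrow> 'm \<Rightarrow> 'o \<Rightarrow> 'm \<Rightarrow> 'm \<Rightarrow> bool" where
  "yetter_drinfeld_module C A \<sigma>CC \<sigma>AA \<sigma>CA M \<rho> \<delta> \<longleftrightarrow>
     braided_module A \<sigma>AA M \<rho> \<and> braided_comodule C \<sigma>CC M \<delta> \<and>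
     \<delta> \<cdot> \<rho> = (\<rho> \<otimes> \<one> C) \<cdot> (\<one> M \<otimes> \<sigma>CA) \<cdot> (\<delta> \<otimes> \<one> A)"

text \<open>The braiding on \<open>M \<odot> N\<close>: it uses the action \<open>\<rho>\<close> on \<open>M\<close> and the coaction \<open>\<delta>\<close> on \<open>N\<close>.\<close>

definition sigma_gYD ::
    "('o \<Rightarrow> 'o \<Rightarrow> 'm) \<Rightarrow> 'm \<Rightarrow> 'o \<Rightarrow> 'm \<Rightarrow> 'o \<Rightarrow> 'm \<Rightarrow> 'm" where
  "sigma_gYD c \<pi> M \<rho> N \<delta> = (\<one> N \<otimes> \<rho>) \<cdot> (c M N \<otimes> \<pi>) \<cdot> (\<one> M \<otimes> \<delta>)"

end

end

theory Submission
  imports Defs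
begin

text \<open>
  Think of \<open>C\<close> as acting on each module \<open>U\<close> through \<open>\<pi>\<close>, by \<open>\<phi> = \<rho> \<cdot> (\<one> U \<otimes> \<pi>)\<close>. The
  generalised Yetter-Drinfel'd braiding on \<open>U \<odot> V\<close> then splits off an element of \<open>C\<close> from \<open>V\<close>,
  carries \<open>U\<close> across \<open>V\<close>, and lets the split-off element act on \<open>U\<close>.

  For Yetter-Drinfel'd modules over a Hopf algebra one proves the Yang-Baxter equation by noting
  that braiding \<open>U \<odot> V\<close> past \<open>W\<close> uses the action on \<open>U \<odot> V\<close> and that the braiding of \<open>U\<close> with \<open>V\<close> is
  equivariant. The same argument works here, although neither coassociativity nor associativity is
  available. Moving \<open>W\<close> past \<open>V\<close> and then past \<open>U\<close> applies the coaction of \<open>W\<close> twice and lets the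
  two resulting factors act on \<open>U\<close> and on \<open>V\<close>: by lemma \<open>braiding_hexagon\<close>, this composite is
  the \<^emph>\<open>double coaction\<close> of \<open>W\<close> followed by the \<^emph>\<open>diagonal action\<close> of \<open>C \<odot> C\<close> on \<open>U \<odot> V\<close>. The double
  coaction is natural in \<open>U \<odot> V\<close>, so both sides of the Yang-Baxter equation become the double
  coaction of \<open>W\<close> followed by a morphism \<open>U \<odot> V \<odot> C \<odot> C \<rightarrow> V \<odot> U\<close>; on one side one braids \<open>U\<close> with
  \<open>V\<close> and acts afterwards, on the other one acts first. Hence it suffices that the braiding of \<open>U\<close>
  with \<open>V\<close> intertwines the diagonal actions, and only up to powers of \<open>\<sigma>CC\<close>, because the braided
  comodule axiom lets the double coaction absorb these (\<open>yang_baxter_of_intertwining\<close>).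

  The intertwining property is what the hypothesis on \<open>\<pi>\<close> encodes. Both composites consist of one
  coaction on \<open>V\<close> at the start, one action on \<open>V\<close> and two actions on \<open>U\<close> at the end, and in between,
  apart from crossings, a morphism \<open>f: C \<odot> C \<odot> C \<rightarrow> A \<odot> A \<odot> A\<close> (\<open>sandwich\<close>). Acting after braiding gives for \<open>f\<close> the core of
  the right-hand side of the hypothesis (\<open>diagonal_action_after_braiding_sandwich\<close>). In the other
  order the action on \<open>V\<close> precedes the coaction on \<open>V\<close>; the Yetter-Drinfel'd condition swaps the two
  at the price of \<open>\<sigma>CA\<close>, and \<open>f\<close> becomes the core of the left-hand side
  (\<open>braiding_after_diagonal_action_sandwich\<close>). The powers of \<open>\<sigma>AA\<close> disappear into the double action
  on \<open>U\<close> by the braided module axiom, and those of \<open>\<sigma>CC\<close> are the ones absorbed by \<open>W\<close>.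
\<close>

section \<open>Rewriting in a strict monoidal category\<close>

text \<open>
  String-diagram arguments are carried out on words of layers \<open>\<one> X \<otimes> f \<otimes> \<one> Y\<close>, with
  composition nested to the right, tensor products nested to the left and identities split into
  their tensor factors; \<open>layer_form\<close>
  brings a morphism into this shape. A single move of a diagram is an equation between words of two
  or three layers, which \<open>in_context\<close> places between further strands and \<open>rewrite_prefix\<close> places
  before further layers. For the conditions of these rules to be decided by rewriting, the axioms
  are restated with membership in \<open>Arr\<close> and equations for \<open>Dom\<close> and \<open>Cod\<close>.
\<close>

context category
begin

lemma arr_of_hom:
  assumes "f \<in> hom \<C> X Y"
  shows "f \<in> Arr \<C>" "Dom \<C> f = X" "Cod \<C> f = Y"
  using assms by (simp_all add: hom_def)

lemma hom_of_arr: "f \<in> Arr \<C> \<Longrightarrow> f \<in> hom \<C> (Dom \<C> f) (Cod \<C> f)"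
  by (simp add: hom_def)

lemma id_typing [simp]:
  assumes "X \<in> Obj \<C>"
  shows "\<one> X \<in> Arr \<C>" "Dom \<C> (\<one> X) = X" "Cod \<C> (\<one> X) = X"
  using arr_of_hom[OF id_hom[OF assms]] by auto

lemma comp_typing [simp]:
  assumes "f \<in> Arr \<C>" "g \<in> Arr \<C>" "Dom \<C> g = Cod \<C> f"
  shows "g \<cdot> f \<in> Arr \<C>" "Dom \<C> (g \<cdot> f) = Dom \<C> f" "Cod \<C> (g \<cdot> f) = Cod \<C> g"
  using arr_of_hom[OF comp_hom, of f "Dom \<C> f" "Cod \<C> f" g "Cod \<C> g"] assms
  by (auto simp: hom_def)

lemma comp_assoc_arr [simp]:
  assumes "f \<in> Arr \<C>" "g \<in> Arr \<C>" "h \<in> Arr \<C>" "Dom \<C> g = Cod \<C> f" "Dom \<C> h = Cod \<C> g"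
  shows "(h \<cdot> g) \<cdot> f = h \<cdot> g \<cdot> f"
  using comp_assoc[of f _ _ g _ h] assms by (simp add: hom_def)

lemma comp_id_arr [simp]:
  assumes "f \<in> Arr \<C>"
  shows "Cod \<C> f = Y \<Longrightarrow> \<one> Y \<cdot> f = f" "Dom \<C> f = X \<Longrightarrow> f \<cdot> \<one> X = f"
  using comp_id_left comp_id_right hom_of_arr[OF assms] by auto

lemma rewrite_prefix:
  assumes "g \<cdot> f = k" "z \<in> Arr \<C>" "f \<in> Arr \<C>" "g \<in> Arr \<C>" "Dom \<C> g = Cod \<C> f" "Dom \<C> f = Cod \<C> z"
  shows "g \<cdot> f \<cdot> z = k \<cdot> z"
  using comp_assoc_arr[of z f g] assms by simp

lemma rewrite_prefix3:
  assumes "h \<cdot> g \<cdot> f = k" "z \<in> Arr \<C>" "f \<in> Arr \<C>" "g \<in> Arr \<C>" "h \<in> Arr \<C>"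
    "Dom \<C> h = Cod \<C> g" "Dom \<C> g = Cod \<C> f" "Dom \<C> f = Cod \<C> z"
  shows "h \<cdot> g \<cdot> f \<cdot> z = k \<cdot> z"
  using comp_assoc_arr[of z "g \<cdot> f" h] assms by simp

end

context strict_monoidal_category
begin

lemmas [simp] = tensor_obj tensor_obj_assoc[symmetric] unit_obj unit_obj_left unit_obj_right
  unit_arr_left unit_arr_right

lemma tensor_typing [simp]:
  assumes "f \<in> Arr \<C>" "g \<in> Arr \<C>"
  shows "f \<otimes> g \<in> Arr \<C>" "Dom \<C> (f \<otimes> g) = Dom \<C> f \<odot> Dom \<C> g"
    "Cod \<C> (f \<otimes> g) = Cod \<C> f \<odot> Cod \<C> g"
  using arr_of_hom[OF tensor_hom[OF hom_of_arr[OF assms(1)] hom_of_arr[OF assms(2)]]] by auto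

lemma interchange_arr:
  assumes "f \<in> Arr \<C>" "f' \<in> Arr \<C>" "g \<in> Arr \<C>" "g' \<in> Arr \<C>"
    "Dom \<C> f' = Cod \<C> f" "Dom \<C> g' = Cod \<C> g"
  shows "(f' \<otimes> g') \<cdot> (f \<otimes> g) = (f' \<cdot> f) \<otimes> (g' \<cdot> g)"
  using interchange[of f _ _ f' _ g _ _ g'] assms by (simp add: hom_def)

lemma comp_tensor:
  assumes "f \<in> Arr \<C>" "g \<in> Arr \<C>" "h \<in> Arr \<C>" "Dom \<C> g = Cod \<C> f"
  shows "(g \<cdot> f) \<otimes> h = (g \<otimes> h) \<cdot> (f \<otimes> \<one> (Dom \<C> h))"
  using assms by (simp add: interchange_arr dom_closed)

lemma tensor_comp:
  assumes "f \<in> Arr \<C>" "g \<in> Arr \<C>" "h \<in> Arr \<C>" "Dom \<C> g = Cod \<C> f"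
  shows "h \<otimes> (g \<cdot> f) = (h \<otimes> g) \<cdot> (\<one> (Dom \<C> h) \<otimes> f)"
  using assms by (simp add: interchange_arr dom_closed)

lemma exchange:
  assumes "f \<in> Arr \<C>" "g \<in> Arr \<C>"
  shows "(\<one> (Cod \<C> f) \<otimes> g) \<cdot> (f \<otimes> \<one> (Dom \<C> g)) = (f \<otimes> \<one> (Cod \<C> g)) \<cdot> (\<one> (Dom \<C> f) \<otimes> g)"
    "(\<one> (Cod \<C> f) \<otimes> g) \<cdot> (f \<otimes> \<one> (Dom \<C> g)) = f \<otimes> g"
    "(f \<otimes> \<one> (Cod \<C> g)) \<cdot> (\<one> (Dom \<C> f) \<otimes> g) = f \<otimes> g"
  using assms by (simp_all add: interchange_arr dom_closed cod_closed)

text \<open>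
  Taking \<open>X\<close> or \<open>Y\<close> to be \<open>\<I>\<close> adds strands on one side only.
\<close>

lemma in_context: "f = g \<Longrightarrow> \<one> X \<otimes> f \<otimes> \<one> Y = \<one> X \<otimes> g \<otimes> \<one> Y"
  by simp

lemmas layer_form = comp_tensor tensor_comp tensor_id[symmetric] tensor_arr_assoc[symmetric]

end

context symmetric_strict_monoidal_category
begin

lemma sym_typing [simp]:
  assumes "X \<in> Obj \<C>" "Y \<in> Obj \<C>"
  shows "c X Y \<in> Arr \<C>" "Dom \<C> (c X Y) = X \<odot> Y" "Cod \<C> (c X Y) = Y \<odot> X"
  using arr_of_hom[OF sym_hom[OF assms]] by auto

lemma sym_naturality:
  assumes "f \<in> Arr \<C>" "g \<in> Arr \<C>"
  shows "c (Cod \<C> f) (Cod \<C> g) \<cdot> (f \<otimes> g) = (g \<otimes> f) \<cdot> c (Dom \<C> f) (Dom \<C> g)"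
  using sym_natural hom_of_arr assms by blast

end

section \<open>Powers of an absorbed endomorphism\<close>

lemma (in category) endo_power_hom:
  assumes "s \<in> hom \<C> X X"
  shows "endo_power \<C> s n \<in> hom \<C> X X"
proof (induction n)
  case 0
  show ?case
    using assms dom_closed[of s] id_hom by (auto simp: hom_def)
next
  case (Suc n)
  with assms comp_hom show ?case by simp
qed

lemma (in strict_monoidal_category) endo_power_absorb_left:
  assumes X: "X \<in> Obj \<C>" and s: "s \<in> hom \<C> Y Y" and f: "f \<in> hom \<C> Z (X \<odot> Y)"
    and inv: "f = (\<one> X \<otimes> s) \<cdot> f"
  shows "(\<one> X \<otimes> endo_power \<C> s n) \<cdot> f = f"
proof (induction n)
  case 0
  note [simp] = X arr_of_hom[OF s] arr_of_hom[OF f]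
  have "Y \<in> Obj \<C>" using dom_closed[of s] by simp
  then show ?case by (simp add: tensor_id)
next
  case (Suc n)
  note [simp] = X arr_of_hom[OF s] arr_of_hom[OF f] arr_of_hom[OF endo_power_hom[OF s, of n]]
  from Suc show ?case by (simp add: tensor_comp inv[symmetric])
qed

lemma (in strict_monoidal_category) endo_power_absorb_right:
  assumes X: "X \<in> Obj \<C>" and s: "s \<in> hom \<C> Y Y" and f: "f \<in> hom \<C> (X \<odot> Y) Z"
    and inv: "f = f \<cdot> (\<one> X \<otimes> s)"
  shows "f \<cdot> (\<one> X \<otimes> endo_power \<C> s n) = f"
proof (induction n)
  case 0
  note [simp] = X arr_of_hom[OF s] arr_of_hom[OF f]
  have "Y \<in> Obj \<C>" using dom_closed[of s] by simp
  then show ?case by (simp add: tensor_id)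
next
  case (Suc n)
  note [simp] = X arr_of_hom[OF s] arr_of_hom[OF f] arr_of_hom[OF endo_power_hom[OF s, of n]]
  from Suc show ?case by (simp add: tensor_comp inv[symmetric] rewrite_prefix[OF inv[symmetric]])
qed

section \<open>Braidings from an action and a coaction\<close>

context symmetric_strict_monoidal_category
begin

text \<open>
  The special case \<open>A = C\<close>, \<open>\<pi> = \<one> C\<close> of the generalised Yetter-Drinfel'd braiding, to which the
  general one reduces by composing the action with \<open>\<pi>\<close>; here \<open>\<phi>\<close> and \<open>\<delta>\<close> are arbitrary
  morphisms of the right type.
\<close>

definition braiding :: "'o \<Rightarrow> 'o \<Rightarrow> 'm \<Rightarrow> 'o \<Rightarrow> 'm \<Rightarrow> 'm" where
  "braiding C U \<phi> V \<delta> = (\<one> V \<otimes> \<phi>) \<cdot> (c U V \<otimes> \<one> C) \<cdot> (\<one> U \<otimes> \<delta>)"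

definition diagonal_action :: "'o \<Rightarrow> 'o \<Rightarrow> 'm \<Rightarrow> 'o \<Rightarrow> 'm \<Rightarrow> 'm" where
  "diagonal_action C U \<phi> V \<psi> = (\<phi> \<otimes> \<psi>) \<cdot> (\<one> U \<otimes> c V C \<otimes> \<one> C)"

definition double_coaction :: "'o \<Rightarrow> 'o \<Rightarrow> 'o \<Rightarrow> 'm \<Rightarrow> 'm" where
  "double_coaction C X W \<delta> = (c X W \<otimes> \<one> (C \<odot> C)) \<cdot> (\<one> X \<otimes> ((\<delta> \<otimes> \<one> C) \<cdot> \<delta>))"

lemma braiding_hom:
  assumes [simp]: "C \<in> Obj \<C>" "U \<in> Obj \<C>" "V \<in> Obj \<C>"
    and \<phi>: "\<phi> \<in> hom \<C> (U \<odot> C) U" and \<delta>: "\<delta> \<in> hom \<C> V (V \<odot> C)"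
  shows "braiding C U \<phi> V \<delta> \<in> hom \<C> (U \<odot> V) (V \<odot> U)"
proof -
  note [simp] = arr_of_hom[OF \<phi>] arr_of_hom[OF \<delta>]
  show ?thesis by (simp add: hom_def braiding_def)
qed

lemma diagonal_action_hom:
  assumes [simp]: "C \<in> Obj \<C>" "U \<in> Obj \<C>" "V \<in> Obj \<C>"
    and \<phi>: "\<phi> \<in> hom \<C> (U \<odot> C) U" and \<psi>: "\<psi> \<in> hom \<C> (V \<odot> C) V"
  shows "diagonal_action C U \<phi> V \<psi> \<in> hom \<C> (U \<odot> V \<odot> C \<odot> C) (U \<odot> V)"
proof -
  note [simp] = arr_of_hom[OF \<phi>] arr_of_hom[OF \<psi>]
  show ?thesis by (simp add: hom_def diagonal_action_def)
qed

lemma double_coaction_hom: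
  assumes [simp]: "C \<in> Obj \<C>" "X \<in> Obj \<C>" "W \<in> Obj \<C>"
    and \<delta>: "\<delta> \<in> hom \<C> W (W \<odot> C)"
  shows "double_coaction C X W \<delta> \<in> hom \<C> (X \<odot> W) (W \<odot> X \<odot> C \<odot> C)"
proof -
  note [simp] = arr_of_hom[OF \<delta>]
  show ?thesis by (simp add: hom_def double_coaction_def)
qed

text \<open>
  The two coactions of \<open>W\<close> can be performed before any strand crosses, by naturality of \<open>c\<close>: the action on \<open>V\<close> is disjoint from everything that happens to \<open>W\<close> and \<open>U\<close> later, and moving
  the second coaction of \<open>W\<close> in front of its crossing with \<open>V\<close> makes the new \<open>C\<close> cross \<open>V\<close> instead,
  which is the crossing in the diagonal action.
\<close>

lemma braiding_hexagon:
  assumes [simp]: "C \<in> Obj \<C>" "U \<in> Obj \<C>" "V \<in> Obj \<C>" "W \<in> Obj \<C>"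
    and \<phi>: "\<phi> \<in> hom \<C> (U \<odot> C) U" and \<psi>: "\<psi> \<in> hom \<C> (V \<odot> C) V" and \<delta>: "\<delta> \<in> hom \<C> W (W \<odot> C)"
  shows "(braiding C U \<phi> W \<delta> \<otimes> \<one> V) \<cdot> (\<one> U \<otimes> braiding C V \<psi> W \<delta>) =
    (\<one> W \<otimes> diagonal_action C U \<phi> V \<psi>) \<cdot> double_coaction C (U \<odot> V) W \<delta>"
proof -
  note [simp] = arr_of_hom[OF \<phi>] arr_of_hom[OF \<psi>] arr_of_hom[OF \<delta>]
  have act_past_coaction: "(\<one> U \<otimes> \<delta> \<otimes> \<one> V) \<cdot> (\<one> U \<otimes> \<one> W \<otimes> \<psi>) = (\<one> U \<otimes> \<one> W \<otimes> \<one> C \<otimes> \<psi>) \<cdot> (\<one> U \<otimes> \<delta> \<otimes> \<one> V \<otimes> \<one> C)"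
    using in_context[OF exchange(1)[of \<delta> \<psi>], of U \<I>] by (simp add: layer_form)
  have act_past_crossing: "(c U W \<otimes> \<one> C \<otimes> \<one> V) \<cdot> (\<one> U \<otimes> \<one> W \<otimes> \<one> C \<otimes> \<psi>)
     = (\<one> W \<otimes> \<one> U \<otimes> \<one> C \<otimes> \<psi>) \<cdot> (c U W \<otimes> \<one> C \<otimes> \<one> V \<otimes> \<one> C)"
    using exchange(1)[of "c U W \<otimes> \<one> C" "\<psi>"] by (simp add: layer_form)
  have act_on_both: "(\<one> W \<otimes> \<phi> \<otimes> \<one> V) \<cdot> (\<one> W \<otimes> \<one> U \<otimes> \<one> C \<otimes> \<psi>) = \<one> W \<otimes> \<phi> \<otimes> \<psi>"
    using in_context[OF exchange(3)[of \<phi> \<psi>], of W \<I>] by (simp add: layer_form)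
  \<comment> \<open>The crossing of \<open>V\<close> with \<open>W \<odot> C\<close> splits and leaves the crossing of \<open>V\<close> with \<open>C\<close>.\<close>
  have crossing_past_coaction: "(\<one> U \<otimes> \<delta> \<otimes> \<one> V \<otimes> \<one> C) \<cdot> (\<one> U \<otimes> c V W \<otimes> \<one> C) =
    (\<one> U \<otimes> \<one> W \<otimes> c V C \<otimes> \<one> C) \<cdot> (\<one> U \<otimes> c V W \<otimes> \<one> C \<otimes> \<one> C) \<cdot> (\<one> U \<otimes> \<one> V \<otimes> \<delta> \<otimes> \<one> C)"
    using in_context[OF sym_naturality[of "\<one> V" \<delta>], of U C] by (simp add: sym_hexagon_right layer_form)
  have crossings_commute: "(c U W \<otimes> \<one> C \<otimes> \<one> V \<otimes> \<one> C) \<cdot> (\<one> U \<otimes> \<one> W \<otimes> c V C \<otimes> \<one> C)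
     = (\<one> W \<otimes> \<one> U \<otimes> c V C \<otimes> \<one> C) \<cdot> (c U W \<otimes> \<one> V \<otimes> \<one> C \<otimes> \<one> C)"
    using in_context[OF exchange(1)[of "c U W" "c V C"], of \<I> C] by (simp add: layer_form)
  note s = act_past_coaction act_past_crossing act_on_both crossing_past_coaction crossings_commute
  show ?thesis
    by (simp add: braiding_def diagonal_action_def double_coaction_def layer_form sym_hexagon_left s s[THEN rewrite_prefix])
qed

lemma double_coaction_natural:
  assumes [simp]: "C \<in> Obj \<C>" "W \<in> Obj \<C>" and f: "f \<in> hom \<C> X Y" and \<delta>: "\<delta> \<in> hom \<C> W (W \<odot> C)"
  shows "double_coaction C Y W \<delta> \<cdot> (f \<otimes> \<one> W) = (\<one> W \<otimes> f \<otimes> \<one> C \<otimes> \<one> C) \<cdot> double_coaction C X W \<delta>"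
proof -
  note [simp] = arr_of_hom[OF f] arr_of_hom[OF \<delta>]
  have [simp]: "X \<in> Obj \<C>" "Y \<in> Obj \<C>"
    using dom_closed[of f] cod_closed[of f] by simp_all
  define \<delta>2 where "\<delta>2 = (\<delta> \<otimes> \<one> C) \<cdot> \<delta>"
  have [simp]: "\<delta>2 \<in> Arr \<C>" "Dom \<C> \<delta>2 = W" "Cod \<C> \<delta>2 = W \<odot> C \<odot> C"
    by (simp_all add: \<delta>2_def)
  have s1: "(\<one> Y \<otimes> \<delta>2) \<cdot> (f \<otimes> \<one> W) = (f \<otimes> \<one> W \<otimes> \<one> C \<otimes> \<one> C) \<cdot> (\<one> X \<otimes> \<delta>2)"
    using exchange(1)[of f \<delta>2] by (simp add: layer_form)
  have s2: "(c Y W \<otimes> \<one> C \<otimes> \<one> C) \<cdot> (f \<otimes> \<one> W \<otimes> \<one> C \<otimes> \<one> C) =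
    (\<one> W \<otimes> f \<otimes> \<one> C \<otimes> \<one> C) \<cdot> (c X W \<otimes> \<one> C \<otimes> \<one> C)"
    using in_context[OF sym_naturality[of f "\<one> W"], of \<I> "C \<odot> C"] by (simp add: layer_form)
  show ?thesis
    unfolding double_coaction_def \<delta>2_def[symmetric]
    by (simp add: layer_form s1 s2 s2[THEN rewrite_prefix])
qed

lemma double_coaction_absorb:
  assumes [simp]: "C \<in> Obj \<C>" "W \<in> Obj \<C>" "X \<in> Obj \<C>" and s: "s \<in> hom \<C> (C \<odot> C) (C \<odot> C)"
   and \<delta>: "\<delta> \<in> hom \<C> W (W \<odot> C)"
   and inv: "(\<one> W \<otimes> s) \<cdot> (\<delta> \<otimes> \<one> C) \<cdot> \<delta> = (\<delta> \<otimes> \<one> C) \<cdot> \<delta>"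
  shows "(\<one> W \<otimes> \<one> X \<otimes> s) \<cdot> double_coaction C X W \<delta> = double_coaction C X W \<delta>"
proof -
  note [simp] = arr_of_hom[OF s] arr_of_hom[OF \<delta>]
  have s1: "(\<one> W \<otimes> \<one> X \<otimes> s) \<cdot> (c X W \<otimes> \<one> C \<otimes> \<one> C) = (c X W \<otimes> \<one> C \<otimes> \<one> C) \<cdot> (\<one> X \<otimes> \<one> W \<otimes> s)"
    using exchange(1)[of "c X W" s] by (simp add: layer_form)
  have s2: "(\<one> X \<otimes> \<one> W \<otimes> s) \<cdot> (\<one> X \<otimes> \<delta> \<otimes> \<one> C) \<cdot> (\<one> X \<otimes> \<delta>) = (\<one> X \<otimes> \<delta> \<otimes> \<one> C) \<cdot> (\<one> X \<otimes> \<delta>)"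
    using in_context[OF inv, of X \<I>] by (simp add: layer_form)
  show ?thesis
    by (simp add: double_coaction_def layer_form s1 s1[THEN rewrite_prefix] s2)
qed

text \<open>
  Two endomorphisms \<open>s\<close> and \<open>t\<close> appear because the intertwining property will only be available
  up to different powers of \<open>\<sigma>CC\<close> on its two sides.
\<close>

lemma yang_baxter_of_intertwining:
  assumes [simp]: "C \<in> Obj \<C>" "U \<in> Obj \<C>" "V \<in> Obj \<C>" "W \<in> Obj \<C>"
    and \<phi>: "\<phi> \<in> hom \<C> (U \<odot> C) U" and \<psi>: "\<psi> \<in> hom \<C> (V \<odot> C) V"
    and \<delta>: "\<delta> \<in> hom \<C> V (V \<odot> C)" and \<epsilon>: "\<epsilon> \<in> hom \<C> W (W \<odot> C)"
    and s: "s \<in> hom \<C> (C \<odot> C) (C \<odot> C)" and t: "t \<in> hom \<C> (C \<odot> C) (C \<odot> C)"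
    and s_inv: "(\<one> W \<otimes> s) \<cdot> (\<epsilon> \<otimes> \<one> C) \<cdot> \<epsilon> = (\<epsilon> \<otimes> \<one> C) \<cdot> \<epsilon>"
    and t_inv: "(\<one> W \<otimes> t) \<cdot> (\<epsilon> \<otimes> \<one> C) \<cdot> \<epsilon> = (\<epsilon> \<otimes> \<one> C) \<cdot> \<epsilon>"
    and intertwining: "braiding C U \<phi> V \<delta> \<cdot> diagonal_action C U \<phi> V \<psi> \<cdot> (\<one> (U \<odot> V) \<otimes> s) =
      diagonal_action C V \<psi> U \<phi> \<cdot> (braiding C U \<phi> V \<delta> \<otimes> \<one> (C \<odot> C)) \<cdot> (\<one> (U \<odot> V) \<otimes> t)"
  shows "(braiding C V \<psi> W \<epsilon> \<otimes> \<one> U) \<cdot> (\<one> V \<otimes> braiding C U \<phi> W \<epsilon>) \<cdot> (braiding C U \<phi> V \<delta> \<otimes> \<one> W) =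
    (\<one> W \<otimes> braiding C U \<phi> V \<delta>) \<cdot> (braiding C U \<phi> W \<epsilon> \<otimes> \<one> V) \<cdot> (\<one> U \<otimes> braiding C V \<psi> W \<epsilon>)"
proof -
  let ?\<sigma> = "braiding C U \<phi> V \<delta>" and ?D = "diagonal_action C U \<phi> V \<psi>" and ?D' = "diagonal_action C V \<psi> U \<phi>"
  let ?P = "double_coaction C (U \<odot> V) W \<epsilon>" and ?P' = "double_coaction C (V \<odot> U) W \<epsilon>"
  note [simp] = arr_of_hom[OF \<phi>] arr_of_hom[OF \<psi>] arr_of_hom[OF \<delta>] arr_of_hom[OF \<epsilon>] arr_of_hom[OF s] arr_of_hom[OF t]
  have [simp]: "braiding C U \<phi> W \<epsilon> \<in> hom \<C> (U \<odot> W) (W \<odot> U)" "braiding C V \<psi> W \<epsilon> \<in> hom \<C> (V \<odot> W) (W \<odot> V)"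
    by (simp_all add: braiding_hom \<phi> \<psi> \<epsilon>)
  note [simp] = arr_of_hom[OF this(1)] arr_of_hom[OF this(2)] arr_of_hom[OF braiding_hom[OF assms(1-3) \<phi> \<delta>]]
    arr_of_hom[OF diagonal_action_hom[OF assms(1-3) \<phi> \<psi>]] arr_of_hom[OF diagonal_action_hom[OF assms(1,3,2) \<psi> \<phi>]]
    arr_of_hom[OF double_coaction_hom[OF assms(1) _ assms(4) \<epsilon>]]
  have i: "(\<one> W \<otimes> ?\<sigma>) \<cdot> (\<one> W \<otimes> ?D) \<cdot> (\<one> W \<otimes> \<one> U \<otimes> \<one> V \<otimes> s) =
    (\<one> W \<otimes> ?D') \<cdot> (\<one> W \<otimes> ?\<sigma> \<otimes> \<one> C \<otimes> \<one> C) \<cdot> (\<one> W \<otimes> \<one> U \<otimes> \<one> V \<otimes> t)"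
    using in_context[OF intertwining, of W \<I>] by (simp add: layer_form)
  have a: "(\<one> W \<otimes> \<one> U \<otimes> \<one> V \<otimes> s) \<cdot> ?P = ?P" "(\<one> W \<otimes> \<one> U \<otimes> \<one> V \<otimes> t) \<cdot> ?P = ?P"
    using double_coaction_absorb[OF _ _ _ s \<epsilon> s_inv, of "U \<odot> V"] double_coaction_absorb[OF _ _ _ t \<epsilon> t_inv, of "U \<odot> V"] by (simp_all add: layer_form)
  have "(braiding C V \<psi> W \<epsilon> \<otimes> \<one> U) \<cdot> (\<one> V \<otimes> braiding C U \<phi> W \<epsilon>) \<cdot> (?\<sigma> \<otimes> \<one> W)
    = (\<one> W \<otimes> ?D') \<cdot> ?P' \<cdot> (?\<sigma> \<otimes> \<one> W)"
    using braiding_hexagon[OF _ _ _ _ \<psi> \<phi> \<epsilon>, THEN rewrite_prefix] by simp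
  also have "\<dots> = (\<one> W \<otimes> ?D') \<cdot> (\<one> W \<otimes> ?\<sigma> \<otimes> \<one> C \<otimes> \<one> C) \<cdot> ?P"
    using double_coaction_natural[OF _ _ braiding_hom[OF _ _ _ \<phi> \<delta>] \<epsilon>] by simp
  also have "\<dots> = (\<one> W \<otimes> ?\<sigma>) \<cdot> (\<one> W \<otimes> ?D) \<cdot> ?P"
    using arg_cong[OF i, of "\<lambda>f. f \<cdot> ?P"] by (simp add: a)
  also have "\<dots> = (\<one> W \<otimes> ?\<sigma>) \<cdot> (braiding C U \<phi> W \<epsilon> \<otimes> \<one> V) \<cdot> (\<one> U \<otimes> braiding C V \<psi> W \<epsilon>)"
    using braiding_hexagon[OF _ _ _ _ \<phi> \<psi> \<epsilon>] by simp
  finally show ?thesis .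
qed

section \<open>Acting before and after braiding\<close>

text \<open>
  The action on \<open>U\<close> inside the braiding is postponed until it meets the other one. Its factor \<open>C\<close>, which
  comes from \<open>V\<close>, must then cross the factor that acts on \<open>V\<close> together with \<open>U\<close>: this is \<open>c C C\<close>.
\<close>

lemma diagonal_action_after_braiding:
  assumes [simp]: "C \<in> Obj \<C>" "U \<in> Obj \<C>" "V \<in> Obj \<C>"
    and \<phi>: "\<phi> \<in> hom \<C> (U \<odot> C) U" and \<psi>: "\<psi> \<in> hom \<C> (V \<odot> C) V" and \<delta>: "\<delta> \<in> hom \<C> V (V \<odot> C)"
  shows "diagonal_action C V \<psi> U \<phi> \<cdot> (braiding C U \<phi> V \<delta> \<otimes> \<one> (C \<odot> C)) =
    (\<psi> \<otimes> (\<phi> \<cdot> (\<phi> \<otimes> \<one> C))) \<cdot> (\<one> V \<otimes> c U C \<otimes> \<one> (C \<odot> C)) \<cdot> (\<one> (V \<odot> U) \<otimes> c C C \<otimes> \<one> C)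
      \<cdot> (c U V \<otimes> \<one> (C \<odot> C \<odot> C)) \<cdot> (\<one> U \<otimes> \<delta> \<otimes> \<one> (C \<odot> C))"
proof -
  note [simp] = arr_of_hom[OF \<phi>] arr_of_hom[OF \<psi>] arr_of_hom[OF \<delta>]
  have s1: "(\<one> V \<otimes> c U C \<otimes> \<one> C) \<cdot> (\<one> V \<otimes> \<phi> \<otimes> \<one> C \<otimes> \<one> C) =
    (\<one> V \<otimes> \<one> C \<otimes> \<phi> \<otimes> \<one> C) \<cdot> (\<one> V \<otimes> c U C \<otimes> \<one> C \<otimes> \<one> C) \<cdot> (\<one> V \<otimes> \<one> U \<otimes> c C C \<otimes> \<one> C)"
    using in_context[OF sym_naturality[of \<phi> "\<one> C"], of V C] by (simp add: sym_hexagon_left layer_form)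
  show ?thesis
    by (simp add: braiding_def diagonal_action_def layer_form s1 s1[THEN rewrite_prefix])
qed

text \<open>
  The hypothesis \<open>compat\<close> exchanges the coaction on \<open>V\<close> with the action that precedes it. Everything
  else is the bookkeeping of crossings. It is the only place where \<open>c\<close> has to be symmetric: the first
  factor \<open>C\<close> crosses \<open>V\<close> to reach \<open>U\<close> and is carried back across \<open>V\<close> along with \<open>U\<close>, and these two
  crossings must cancel.
\<close>

lemma braiding_after_diagonal_action:
  assumes [simp]: "C \<in> Obj \<C>" "A \<in> Obj \<C>" "U \<in> Obj \<C>" "V \<in> Obj \<C>"
    and \<phi>: "\<phi> \<in> hom \<C> (U \<odot> C) U" and \<psi>: "\<psi> \<in> hom \<C> (V \<odot> C) V" and \<delta>: "\<delta> \<in> hom \<C> V (V \<odot> C)"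
    and \<rho>: "\<rho> \<in> hom \<C> (V \<odot> A) V" and \<kappa>: "\<kappa> \<in> hom \<C> (C \<odot> C) (A \<odot> C)"
    and compat: "\<delta> \<cdot> \<psi> = (\<rho> \<otimes> \<one> C) \<cdot> (\<one> V \<otimes> \<kappa>) \<cdot> (\<delta> \<otimes> \<one> C)"
  shows "braiding C U \<phi> V \<delta> \<cdot> diagonal_action C U \<phi> V \<psi> =
    (\<rho> \<otimes> (\<phi> \<cdot> (\<phi> \<otimes> \<one> C))) \<cdot> (\<one> V \<otimes> c U A \<otimes> \<one> (C \<odot> C))
      \<cdot> (\<one> (V \<odot> U) \<otimes> ((c C A \<otimes> \<one> C) \<cdot> (\<one> C \<otimes> \<kappa>) \<cdot> (c C C \<otimes> \<one> C)))
      \<cdot> (c U V \<otimes> \<one> (C \<odot> C \<odot> C)) \<cdot> (\<one> U \<otimes> \<delta> \<otimes> \<one> (C \<odot> C))"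
proof -
  note [simp] = arr_of_hom[OF \<phi>] arr_of_hom[OF \<psi>] arr_of_hom[OF \<delta>] arr_of_hom[OF \<rho>] arr_of_hom[OF \<kappa>]
  have split_actions: "\<phi> \<otimes> \<psi> = (\<phi> \<otimes> \<one> V) \<cdot> (\<one> U \<otimes> \<one> C \<otimes> \<psi>)"
    using exchange(3)[of \<phi> \<psi>] by (simp add: layer_form)
  have step1: "(\<one> U \<otimes> \<delta>) \<cdot> (\<phi> \<otimes> \<one> V) = (\<phi> \<otimes> \<one> V \<otimes> \<one> C) \<cdot> (\<one> U \<otimes> \<one> C \<otimes> \<delta>)"
    using exchange(1)[of \<phi> \<delta>] by (simp add: layer_form)
  \<comment> \<open>The coaction on \<open>V\<close> now directly follows the action on \<open>V\<close>.\<close>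
  have step2: "(\<one> U \<otimes> \<one> C \<otimes> \<delta>) \<cdot> (\<one> U \<otimes> \<one> C \<otimes> \<psi>) =
     (\<one> U \<otimes> \<one> C \<otimes> \<rho> \<otimes> \<one> C) \<cdot> (\<one> U \<otimes> \<one> C \<otimes> \<one> V \<otimes> \<kappa>) \<cdot> (\<one> U \<otimes> \<one> C \<otimes> \<delta> \<otimes> \<one> C)"
    using in_context[OF compat, of "U \<odot> C" \<I>] by (simp add: layer_form)
  \<comment> \<open>Both actions are moved to the end, past the crossing of \<open>U\<close> with \<open>V\<close>.\<close>
  have step3: "(c U V \<otimes> \<one> C) \<cdot> (\<phi> \<otimes> \<one> V \<otimes> \<one> C) =
    (\<one> V \<otimes> \<phi> \<otimes> \<one> C) \<cdot> (c U V \<otimes> \<one> C \<otimes> \<one> C) \<cdot> (\<one> U \<otimes> c C V \<otimes> \<one> C)"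
    using in_context[OF sym_naturality[of \<phi> "\<one> V"], of \<I> C] by (simp add: sym_hexagon_left layer_form)
  have step4: "(c U V \<otimes> \<one> C \<otimes> \<one> C) \<cdot> (\<one> U \<otimes> c C V \<otimes> \<one> C) \<cdot> (\<one> U \<otimes> \<one> C \<otimes> \<rho> \<otimes> \<one> C) =
    (\<rho> \<otimes> \<one> U \<otimes> \<one> C \<otimes> \<one> C) \<cdot> (\<one> V \<otimes> c U A \<otimes> \<one> C \<otimes> \<one> C) \<cdot> (\<one> V \<otimes> \<one> U \<otimes> c C A \<otimes> \<one> C)
     \<cdot> (c U V \<otimes> \<one> C \<otimes> \<one> A \<otimes> \<one> C) \<cdot> (\<one> U \<otimes> c C V \<otimes> \<one> A \<otimes> \<one> C)"
    using in_context[OF sym_naturality[of "\<one> (U \<odot> C)" \<rho>], of \<I> C]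
    by (simp add: sym_hexagon_left[of U C V] sym_hexagon_left[of U C A] sym_hexagon_right[of "U \<odot> C" V A] layer_form)
  \<comment> \<open>The crossings with \<open>V\<close> are moved to the beginning, before \<open>\<kappa>\<close>.\<close>
  have step5: "(\<one> U \<otimes> c C V \<otimes> \<one> A \<otimes> \<one> C) \<cdot> (\<one> U \<otimes> \<one> C \<otimes> \<one> V \<otimes> \<kappa>) =
    (\<one> U \<otimes> \<one> V \<otimes> \<one> C \<otimes> \<kappa>) \<cdot> (\<one> U \<otimes> c C V \<otimes> \<one> C \<otimes> \<one> C)"
    using in_context[OF exchange(1)[of "c C V" \<kappa>], of U \<I>] by (simp add: layer_form)
  have step6: "(c U V \<otimes> \<one> C \<otimes> \<one> A \<otimes> \<one> C) \<cdot> (\<one> U \<otimes> \<one> V \<otimes> \<one> C \<otimes> \<kappa>) =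
    (\<one> V \<otimes> \<one> U \<otimes> \<one> C \<otimes> \<kappa>) \<cdot> (c U V \<otimes> \<one> C \<otimes> \<one> C \<otimes> \<one> C)"
    using exchange(1)[of "c U V \<otimes> \<one> C" \<kappa>] by (simp add: layer_form)
  have step7: "(\<one> U \<otimes> \<one> C \<otimes> \<delta> \<otimes> \<one> C) \<cdot> (\<one> U \<otimes> c V C \<otimes> \<one> C) =
    (\<one> U \<otimes> c V C \<otimes> \<one> C \<otimes> \<one> C) \<cdot> (\<one> U \<otimes> \<one> V \<otimes> c C C \<otimes> \<one> C) \<cdot> (\<one> U \<otimes> \<delta> \<otimes> \<one> C \<otimes> \<one> C)"
    using in_context[OF sym_naturality[of \<delta> "\<one> C"], of U C] by (simp add: sym_hexagon_left layer_form)
  \<comment> \<open>A coaction on \<open>V\<close> before the crossing with \<open>C\<close> (\<open>step7\<close>) leaves two opposite crossings of \<open>C\<close> and \<open>V\<close>.\<close>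
  have step8: "(\<one> U \<otimes> c C V \<otimes> \<one> C \<otimes> \<one> C) \<cdot> (\<one> U \<otimes> c V C \<otimes> \<one> C \<otimes> \<one> C) \<cdot> (\<one> U \<otimes> \<one> V \<otimes> c C C \<otimes> \<one> C) =
    \<one> U \<otimes> \<one> V \<otimes> c C C \<otimes> \<one> C"
  proof -
    have "(c C V \<otimes> \<one> C) \<cdot> (c V C \<otimes> \<one> C) = \<one> (V \<odot> C \<odot> C)"
      by (simp add: interchange_arr sym_involutive tensor_id)
    then have "(c C V \<otimes> \<one> C) \<cdot> (c V C \<otimes> \<one> C) \<cdot> (\<one> V \<otimes> c C C) = \<one> V \<otimes> c C C"
      by (simp add: rewrite_prefix)
    from in_context[OF this, of U C] show ?thesis
      by (simp add: layer_form)
  qed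
  have step9: "(c U V \<otimes> \<one> C \<otimes> \<one> C \<otimes> \<one> C) \<cdot> (\<one> U \<otimes> \<one> V \<otimes> c C C \<otimes> \<one> C) =
    (\<one> V \<otimes> \<one> U \<otimes> c C C \<otimes> \<one> C) \<cdot> (c U V \<otimes> \<one> C \<otimes> \<one> C \<otimes> \<one> C)"
    using exchange(1)[of "c U V" "c C C \<otimes> \<one> C"] by (simp add: layer_form)
  have step10: "(\<one> V \<otimes> \<phi> \<otimes> \<one> C) \<cdot> (\<rho> \<otimes> \<one> U \<otimes> \<one> C \<otimes> \<one> C) = (\<rho> \<otimes> \<one> U \<otimes> \<one> C) \<cdot> (\<one> V \<otimes> \<one> A \<otimes> \<phi> \<otimes> \<one> C)"
    using exchange(1)[of \<rho> "\<phi> \<otimes> \<one> C"] by (simp add: layer_form)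
  have step11: "(\<one> V \<otimes> \<phi>) \<cdot> (\<rho> \<otimes> \<one> U \<otimes> \<one> C) = \<rho> \<otimes> \<phi>"
    using exchange(2)[of \<rho> \<phi>] by (simp add: layer_form)
  note s = step1 step2 step3 step5 step6 step7 step9 step10 step11
  show ?thesis
    by (simp add: braiding_def diagonal_action_def layer_form split_actions s s[THEN rewrite_prefix] step4 step4[THEN rewrite_prefix3] step8 step8[THEN rewrite_prefix3])
qed

section \<open>The coefficient morphism\<close>

text \<open>
  The coaction \<open>\<delta>\<close> on \<open>V\<close> produces the first input of \<open>f: C \<odot> C \<odot> C \<rightarrow> A \<odot> A \<odot> A\<close>. Its first output
  acts on \<open>V\<close> and the other two act successively on \<open>U\<close>.
\<close>

definition sandwich :: "'o \<Rightarrow> 'o \<Rightarrow> 'o \<Rightarrow> 'm \<Rightarrow> 'o \<Rightarrow> 'm \<Rightarrow> 'm \<Rightarrow> 'm \<Rightarrow> 'm" where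
  "sandwich C A U \<rho> V \<tau> \<delta> f = (\<tau> \<otimes> (\<rho> \<cdot> (\<rho> \<otimes> \<one> A))) \<cdot> (\<one> V \<otimes> c U A \<otimes> \<one> A \<otimes> \<one> A)
    \<cdot> (\<one> V \<otimes> \<one> U \<otimes> f) \<cdot> (c U V \<otimes> \<one> C \<otimes> \<one> C \<otimes> \<one> C) \<cdot> (\<one> U \<otimes> \<delta> \<otimes> \<one> C \<otimes> \<one> C)"

text \<open>
  Whatever the last two factors \<open>A\<close> undergo can be moved past the crossing with \<open>U\<close>, where the
  double action absorbs it.
\<close>

lemma sandwich_absorb_left:
  assumes [simp]: "C \<in> Obj \<C>" "A \<in> Obj \<C>" "U \<in> Obj \<C>" "V \<in> Obj \<C>"
    and \<rho>: "\<rho> \<in> hom \<C> (U \<odot> A) U" and \<tau>: "\<tau> \<in> hom \<C> (V \<odot> A) V" and \<delta>: "\<delta> \<in> hom \<C> V (V \<odot> C)"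
    and f: "f \<in> hom \<C> (C \<odot> C \<odot> C) (A \<odot> A \<odot> A)" and s: "s \<in> hom \<C> (A \<odot> A) (A \<odot> A)"
    and inv: "(\<rho> \<cdot> (\<rho> \<otimes> \<one> A)) \<cdot> (\<one> U \<otimes> s) = \<rho> \<cdot> (\<rho> \<otimes> \<one> A)"
  shows "sandwich C A U \<rho> V \<tau> \<delta> ((\<one> A \<otimes> s) \<cdot> f) = sandwich C A U \<rho> V \<tau> \<delta> f"
proof -
  note [simp] = arr_of_hom[OF \<rho>] arr_of_hom[OF \<tau>] arr_of_hom[OF \<delta>] arr_of_hom[OF f] arr_of_hom[OF s]
  define \<rho>2 where "\<rho>2 = \<rho> \<cdot> (\<rho> \<otimes> \<one> A)"
  have [simp]: "\<rho>2 \<in> Arr \<C>" "Dom \<C> \<rho>2 = U \<odot> A \<odot> A" "Cod \<C> \<rho>2 = U"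
    by (simp_all add: \<rho>2_def)
  have s1: "(\<one> V \<otimes> c U A \<otimes> \<one> A \<otimes> \<one> A) \<cdot> (\<one> V \<otimes> \<one> U \<otimes> \<one> A \<otimes> s) =
      (\<one> V \<otimes> \<one> A \<otimes> \<one> U \<otimes> s) \<cdot> (\<one> V \<otimes> c U A \<otimes> \<one> A \<otimes> \<one> A)"
    using exchange(1)[of "\<one> V \<otimes> c U A" s] by (simp add: layer_form)
  have s2: "(\<tau> \<otimes> \<rho>2) \<cdot> (\<one> V \<otimes> \<one> A \<otimes> \<one> U \<otimes> s) = \<tau> \<otimes> \<rho>2"
  proof -
    have "\<rho>2 \<cdot> (\<one> U \<otimes> s) = \<rho>2" using inv by (simp only: \<rho>2_def)
    then have "(\<tau> \<otimes> \<rho>2) \<cdot> (\<one> (V \<odot> A) \<otimes> (\<one> U \<otimes> s)) = \<tau> \<otimes> \<rho>2" by (simp add: interchange_arr)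
    then show ?thesis by (simp add: tensor_id[symmetric] tensor_arr_assoc[symmetric])
  qed
  show ?thesis
    unfolding sandwich_def \<rho>2_def[symmetric]
    by (simp add: layer_form s1 s1[THEN rewrite_prefix] s2 s2[THEN rewrite_prefix])
qed

lemma sandwich_precomp:
  assumes [simp]: "C \<in> Obj \<C>" "A \<in> Obj \<C>" "U \<in> Obj \<C>" "V \<in> Obj \<C>"
    and \<rho>: "\<rho> \<in> hom \<C> (U \<odot> A) U" and \<tau>: "\<tau> \<in> hom \<C> (V \<odot> A) V" and \<delta>: "\<delta> \<in> hom \<C> V (V \<odot> C)"
    and f: "f \<in> hom \<C> (C \<odot> C \<odot> C) (A \<odot> A \<odot> A)" and t: "t \<in> hom \<C> (C \<odot> C) (C \<odot> C)"
  shows "sandwich C A U \<rho> V \<tau> \<delta> (f \<cdot> (\<one> C \<otimes> t)) = sandwich C A U \<rho> V \<tau> \<delta> f \<cdot> (\<one> U \<otimes> \<one> V \<otimes> t)"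
proof -
  note [simp] = arr_of_hom[OF \<rho>] arr_of_hom[OF \<tau>] arr_of_hom[OF \<delta>] arr_of_hom[OF f] arr_of_hom[OF t]
  have s1: "(c U V \<otimes> \<one> C \<otimes> \<one> C \<otimes> \<one> C) \<cdot> (\<one> U \<otimes> \<one> V \<otimes> \<one> C \<otimes> t) =
     (\<one> V \<otimes> \<one> U \<otimes> \<one> C \<otimes> t) \<cdot> (c U V \<otimes> \<one> C \<otimes> \<one> C \<otimes> \<one> C)"
    using exchange(1)[of "c U V \<otimes> \<one> C" t] by (simp add: layer_form)
  have s2: "(\<one> U \<otimes> \<delta> \<otimes> \<one> C \<otimes> \<one> C) \<cdot> (\<one> U \<otimes> \<one> V \<otimes> t) = (\<one> U \<otimes> \<one> V \<otimes> \<one> C \<otimes> t) \<cdot> (\<one> U \<otimes> \<delta> \<otimes> \<one> C \<otimes> \<one> C)"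
    using exchange(1)[of "\<one> U \<otimes> \<delta>" t] by (simp add: layer_form)
  show ?thesis
    by (simp add: sandwich_def layer_form s1 s2 s1[THEN rewrite_prefix] s2[THEN rewrite_prefix])
qed

text \<open>
  Turns the actions of \<open>C\<close> on \<open>U\<close> at the end of a composite into actions of \<open>A\<close>, moving both copies of
  \<open>\<pi>\<close> before the crossing so that they become part of the coefficient morphism.
\<close>

lemma sandwich_action:
  assumes [simp]: "C \<in> Obj \<C>" "A \<in> Obj \<C>" "U \<in> Obj \<C>" "V \<in> Obj \<C>"
    and \<rho>: "\<rho> \<in> hom \<C> (U \<odot> A) U" and \<tau>: "\<tau> \<in> hom \<C> (V \<odot> A) V"
    and \<pi>: "\<pi> \<in> hom \<C> C A" and \<phi>: "\<phi> = \<rho> \<cdot> (\<one> U \<otimes> \<pi>)"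
  shows "(\<tau> \<otimes> (\<phi> \<cdot> (\<phi> \<otimes> \<one> C))) \<cdot> (\<one> V \<otimes> c U A \<otimes> \<one> C \<otimes> \<one> C) =
    (\<tau> \<otimes> (\<rho> \<cdot> (\<rho> \<otimes> \<one> A))) \<cdot> (\<one> V \<otimes> c U A \<otimes> \<one> A \<otimes> \<one> A) \<cdot> (\<one> V \<otimes> \<one> U \<otimes> \<one> A \<otimes> \<pi> \<otimes> \<pi>)"
proof -
  note [simp] = arr_of_hom[OF \<rho>] arr_of_hom[OF \<tau>] arr_of_hom[OF \<pi>]
  have p: "\<pi> \<otimes> \<pi> = (\<one> A \<otimes> \<pi>) \<cdot> (\<pi> \<otimes> \<one> C)"
    using exchange(2)[of \<pi> \<pi>] by simp
  have s0: "(\<one> U \<otimes> \<pi>) \<cdot> (\<rho> \<otimes> \<one> C) = (\<rho> \<otimes> \<one> A) \<cdot> (\<one> U \<otimes> \<one> A \<otimes> \<pi>)"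
    using exchange(1)[of \<rho> \<pi>] by (simp add: layer_form)
  have s1: "\<phi> \<cdot> (\<phi> \<otimes> \<one> C) = (\<rho> \<cdot> (\<rho> \<otimes> \<one> A)) \<cdot> (\<one> U \<otimes> (\<pi> \<otimes> \<pi>))"
    by (simp add: \<phi> p layer_form s0 s0[THEN rewrite_prefix])
  have s2: "(\<one> V \<otimes> c U A \<otimes> \<one> A \<otimes> \<one> A) \<cdot> (\<one> V \<otimes> \<one> U \<otimes> \<one> A \<otimes> \<pi> \<otimes> \<pi>) =
     (\<one> V \<otimes> \<one> A \<otimes> \<one> U \<otimes> \<pi> \<otimes> \<pi>) \<cdot> (\<one> V \<otimes> c U A \<otimes> \<one> C \<otimes> \<one> C)"
    using exchange(1)[of "\<one> V \<otimes> c U A" "\<pi> \<otimes> \<pi>"] by (simp add: layer_form)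
  show ?thesis
    unfolding s1 by (simp add: layer_form s2)
qed

text \<open>
  By naturality the coefficient morphism is \<open>(\<pi> \<otimes> \<pi> \<otimes> \<pi>) \<cdot> (c C C \<otimes> \<one> C)\<close>, which is the
  crossing of the two factors found in \<open>diagonal_action_after_braiding\<close>.
\<close>

lemma diagonal_action_after_braiding_sandwich:
  assumes [simp]: "C \<in> Obj \<C>" "A \<in> Obj \<C>" "U \<in> Obj \<C>" "V \<in> Obj \<C>"
    and \<rho>: "\<rho> \<in> hom \<C> (U \<odot> A) U" and \<tau>: "\<tau> \<in> hom \<C> (V \<odot> A) V" and \<delta>: "\<delta> \<in> hom \<C> V (V \<odot> C)"
    and \<pi>: "\<pi> \<in> hom \<C> C A" and \<phi>: "\<phi> = \<rho> \<cdot> (\<one> U \<otimes> \<pi>)" and \<psi>: "\<psi> = \<tau> \<cdot> (\<one> V \<otimes> \<pi>)"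
  shows "diagonal_action C V \<psi> U \<phi> \<cdot> (braiding C U \<phi> V \<delta> \<otimes> \<one> (C \<odot> C)) =
    sandwich C A U \<rho> V \<tau> \<delta> ((\<one> A \<otimes> \<pi> \<otimes> \<one> A) \<cdot> (c C A \<otimes> \<pi>) \<cdot> (\<one> C \<otimes> \<pi> \<otimes> \<one> C))"
proof -
  note [simp] = arr_of_hom[OF \<rho>] arr_of_hom[OF \<tau>] arr_of_hom[OF \<delta>] arr_of_hom[OF \<pi>]
  have \<phi>h: "\<phi> \<in> hom \<C> (U \<odot> C) U" and \<psi>h: "\<psi> \<in> hom \<C> (V \<odot> C) V"
    by (simp_all add: \<phi> \<psi> hom_def)
  note [simp] = arr_of_hom[OF \<phi>h]
  have n: "c C A \<cdot> (\<one> C \<otimes> \<pi>) = (\<pi> \<otimes> \<one> C) \<cdot> c C C"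
    using sym_naturality[of "\<one> C" \<pi>] by simp
  have "(\<one> A \<otimes> \<pi> \<otimes> \<one> A) \<cdot> (c C A \<otimes> \<pi>) \<cdot> (\<one> C \<otimes> \<pi> \<otimes> \<one> C) = (((\<one> A \<otimes> \<pi>) \<cdot> (\<pi> \<otimes> \<one> C) \<cdot> c C C) \<otimes> \<pi>)"
    by (simp add: interchange_arr n)
  also have "\<dots> = (\<one> A \<otimes> \<pi> \<otimes> \<pi>) \<cdot> (\<pi> \<otimes> \<one> C \<otimes> \<one> C) \<cdot> (c C C \<otimes> \<one> C)"
    by (simp add: interchange_arr)
  finally have H: "(\<one> A \<otimes> \<pi> \<otimes> \<one> A) \<cdot> (c C A \<otimes> \<pi>) \<cdot> (\<one> C \<otimes> \<pi> \<otimes> \<one> C) = \<dots>" .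
  have p: "\<psi> \<otimes> (\<phi> \<cdot> (\<phi> \<otimes> \<one> C)) = (\<tau> \<otimes> (\<phi> \<cdot> (\<phi> \<otimes> \<one> C))) \<cdot> (\<one> V \<otimes> \<pi> \<otimes> \<one> U \<otimes> \<one> C \<otimes> \<one> C)"
    unfolding \<psi> using comp_tensor[of "\<one> V \<otimes> \<pi>" \<tau> "\<phi> \<cdot> (\<phi> \<otimes> \<one> C)"] by (simp add: tensor_id[symmetric] tensor_arr_assoc[symmetric])
  have q: "(\<one> V \<otimes> \<pi> \<otimes> \<one> U \<otimes> \<one> C \<otimes> \<one> C) \<cdot> (\<one> V \<otimes> c U C \<otimes> \<one> C \<otimes> \<one> C) =
    (\<one> V \<otimes> c U A \<otimes> \<one> C \<otimes> \<one> C) \<cdot> (\<one> V \<otimes> \<one> U \<otimes> \<pi> \<otimes> \<one> C \<otimes> \<one> C)"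
    using in_context[OF sym_naturality[of "\<one> U" \<pi>], of V "C \<odot> C"] by (simp add: layer_form)
  show ?thesis
    unfolding sandwich_def diagonal_action_after_braiding[OF assms(1,3,4) \<phi>h \<psi>h \<delta>] H p
    using sandwich_action[OF assms(1-4) \<rho> \<tau> \<pi> \<phi>, THEN rewrite_prefix]
    by (simp add: tensor_comp tensor_id[symmetric] tensor_arr_assoc[symmetric] q q[THEN rewrite_prefix])
qed

text \<open>
  The Yetter-Drinfel'd condition for the action \<open>\<tau>\<close> of \<open>A\<close> gives the condition required in
  \<open>braiding_after_diagonal_action\<close> for \<open>\<psi>\<close>, with \<open>\<kappa> = \<sigma> \<cdot> (\<one> C \<otimes> \<pi>)\<close>.
\<close>

lemma braiding_after_diagonal_action_sandwich:
  assumes [simp]: "C \<in> Obj \<C>" "A \<in> Obj \<C>" "U \<in> Obj \<C>" "V \<in> Obj \<C>"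
    and \<rho>: "\<rho> \<in> hom \<C> (U \<odot> A) U" and \<tau>: "\<tau> \<in> hom \<C> (V \<odot> A) V" and \<delta>: "\<delta> \<in> hom \<C> V (V \<odot> C)"
    and \<pi>: "\<pi> \<in> hom \<C> C A" and \<sigma>: "\<sigma> \<in> hom \<C> (C \<odot> A) (A \<odot> C)"
    and \<phi>: "\<phi> = \<rho> \<cdot> (\<one> U \<otimes> \<pi>)" and \<psi>: "\<psi> = \<tau> \<cdot> (\<one> V \<otimes> \<pi>)"
    and compat: "\<delta> \<cdot> \<tau> = (\<tau> \<otimes> \<one> C) \<cdot> (\<one> V \<otimes> \<sigma>) \<cdot> (\<delta> \<otimes> \<one> A)"
  shows "braiding C U \<phi> V \<delta> \<cdot> diagonal_action C U \<phi> V \<psi> =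
    sandwich C A U \<rho> V \<tau> \<delta> ((c A A \<otimes> \<pi>) \<cdot> (\<pi> \<otimes> \<sigma>) \<cdot> (c C C \<otimes> \<pi>))"
proof -
  note [simp] = arr_of_hom[OF \<rho>] arr_of_hom[OF \<tau>] arr_of_hom[OF \<delta>] arr_of_hom[OF \<pi>] arr_of_hom[OF \<sigma>]
  have \<phi>h: "\<phi> \<in> hom \<C> (U \<odot> C) U" and \<psi>h: "\<psi> \<in> hom \<C> (V \<odot> C) V"
    by (simp_all add: \<phi> \<psi> hom_def)
  note [simp] = arr_of_hom[OF \<phi>h]
  define \<kappa> where "\<kappa> = \<sigma> \<cdot> (\<one> C \<otimes> \<pi>)"
  have \<kappa>h: "\<kappa> \<in> hom \<C> (C \<odot> C) (A \<odot> C)"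
    by (simp add: \<kappa>_def hom_def)
  note [simp] = arr_of_hom[OF \<kappa>h]
  have n: "c A A \<cdot> (\<pi> \<otimes> \<one> A) = (\<one> A \<otimes> \<pi>) \<cdot> c C A"
    using sym_naturality[of \<pi> "\<one> A"] by simp
  have h1: "\<pi> \<otimes> \<sigma> = (\<pi> \<otimes> \<one> A \<otimes> \<one> C) \<cdot> (\<one> C \<otimes> \<sigma>)"
    using exchange(3)[of \<pi> \<sigma>] by (simp add: layer_form)
  have h2: "c C C \<otimes> \<pi> = (\<one> C \<otimes> \<one> C \<otimes> \<pi>) \<cdot> (c C C \<otimes> \<one> C)"
    using exchange(2)[of "c C C" \<pi>] by (simp add: layer_form)
  have h3: "(c A A \<otimes> \<pi>) \<cdot> (\<pi> \<otimes> \<one> A \<otimes> \<one> C) = (\<one> A \<otimes> \<pi> \<otimes> \<pi>) \<cdot> (c C A \<otimes> \<one> C)"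
    by (simp add: interchange_arr n)
  \<comment> \<open>All copies of \<open>\<pi>\<close> except the one in \<open>\<kappa>\<close> are collected at the output end.\<close>
  have H: "(c A A \<otimes> \<pi>) \<cdot> (\<pi> \<otimes> \<sigma>) \<cdot> (c C C \<otimes> \<pi>) =
     (\<one> A \<otimes> \<pi> \<otimes> \<pi>) \<cdot> (c C A \<otimes> \<one> C) \<cdot> (\<one> C \<otimes> \<kappa>) \<cdot> (c C C \<otimes> \<one> C)"
    by (simp add: h1 h2 h3[THEN rewrite_prefix] \<kappa>_def layer_form)
  have "(\<delta> \<otimes> \<one> A) \<cdot> (\<one> V \<otimes> \<pi>) = (\<one> V \<otimes> \<one> C \<otimes> \<pi>) \<cdot> (\<delta> \<otimes> \<one> C)"
    using exchange(1)[of \<delta> \<pi>] by (simp add: layer_form)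
  then have compat': "\<delta> \<cdot> \<psi> = (\<tau> \<otimes> \<one> C) \<cdot> (\<one> V \<otimes> \<kappa>) \<cdot> (\<delta> \<otimes> \<one> C)"
    by (simp add: \<psi> \<kappa>_def compat[THEN rewrite_prefix] layer_form)
  show ?thesis
    unfolding sandwich_def braiding_after_diagonal_action[OF assms(1-4) \<phi>h \<psi>h \<delta> \<tau> \<kappa>h compat'] H
    using sandwich_action[OF assms(1-4) \<rho> \<tau> \<pi> \<phi>, THEN rewrite_prefix]
    by (simp add: tensor_comp tensor_id[symmetric] tensor_arr_assoc[symmetric])
qed

section \<open>The generalised Yetter-Drinfel'd braiding\<close>

lemma sigma_gYD_eq_braiding:
  assumes [simp]: "C \<in> Obj \<C>" "A \<in> Obj \<C>" "U \<in> Obj \<C>" "V \<in> Obj \<C>"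
    and \<rho>: "\<rho> \<in> hom \<C> (U \<odot> A) U" and \<delta>: "\<delta> \<in> hom \<C> V (V \<odot> C)" and \<pi>: "\<pi> \<in> hom \<C> C A"
  shows "sigma_gYD \<C> c \<pi> U \<rho> V \<delta> = braiding C U (\<rho> \<cdot> (\<one> U \<otimes> \<pi>)) V \<delta>"
proof -
  note [simp] = arr_of_hom[OF \<rho>] arr_of_hom[OF \<delta>] arr_of_hom[OF \<pi>]
  have "c U V \<otimes> \<pi> = (\<one> V \<otimes> \<one> U \<otimes> \<pi>) \<cdot> (c U V \<otimes> \<one> C)"
    using exchange(2)[of "c U V" \<pi>] by (simp add: layer_form)
  then show ?thesis
    by (simp add: sigma_gYD_def braiding_def layer_form)
qed

lemma sigma_gYD_hom:
  assumes [simp]: "U \<in> Obj \<C>" "V \<in> Obj \<C>"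
    and \<rho>: "\<rho> \<in> hom \<C> (U \<odot> A) U" and \<delta>: "\<delta> \<in> hom \<C> V (V \<odot> C)" and \<pi>: "\<pi> \<in> hom \<C> C A"
  shows "sigma_gYD \<C> c \<pi> U \<rho> V \<delta> \<in> hom \<C> (U \<odot> V) (V \<odot> U)"
proof -
  note [simp] = arr_of_hom[OF \<rho>] arr_of_hom[OF \<delta>] arr_of_hom[OF \<pi>]
  have [simp]: "C \<in> Obj \<C>" "A \<in> Obj \<C>"
    using dom_closed[of \<pi>] cod_closed[of \<pi>] by simp_all
  show ?thesis by (simp add: sigma_gYD_def hom_def)
qed

text \<open>
  Each of the three objects contributes a different Yetter-Drinfel'd axiom: \<open>U\<close> the one on its
  action, \<open>W\<close> the one on its coaction, and \<open>V\<close> the compatibility of its action and coaction.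
\<close>

lemma sigma_gYD_yang_baxter:
  assumes \<pi>: "\<pi> \<in> hom \<C> C A"
    and \<sigma>CC: "\<sigma>CC \<in> hom \<C> (C \<odot> C) (C \<odot> C)" and \<sigma>AA: "\<sigma>AA \<in> hom \<C> (A \<odot> A) (A \<odot> A)"
    and \<sigma>CA: "\<sigma>CA \<in> hom \<C> (C \<odot> A) (A \<odot> C)"
    and coeff: "(\<one> A \<otimes> endo_power \<C> \<sigma>AA \<alpha>\<^sub>1) \<cdot> (c A A \<otimes> \<pi>) \<cdot> (\<pi> \<otimes> \<sigma>CA) \<cdot> (c C C \<otimes> \<pi>)
           \<cdot> (\<one> C \<otimes> endo_power \<C> \<sigma>CC \<gamma>\<^sub>1) =
         (\<one> A \<otimes> endo_power \<C> \<sigma>AA \<alpha>\<^sub>2) \<cdot> (\<one> A \<otimes> \<pi> \<otimes> \<one> A) \<cdot> (c C A \<otimes> \<pi>) \<cdot> (\<one> C \<otimes> \<pi> \<otimes> \<one> C)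
           \<cdot> (\<one> C \<otimes> endo_power \<C> \<sigma>CC \<gamma>\<^sub>2)"
    and U: "braided_module \<C> A \<sigma>AA U \<rho>"
    and V: "V \<in> Obj \<C>" and \<tau>: "\<tau> \<in> hom \<C> (V \<odot> A) V" and \<delta>: "\<delta> \<in> hom \<C> V (V \<odot> C)"
    and compat: "\<delta> \<cdot> \<tau> = (\<tau> \<otimes> \<one> C) \<cdot> (\<one> V \<otimes> \<sigma>CA) \<cdot> (\<delta> \<otimes> \<one> A)"
    and W: "braided_comodule \<C> C \<sigma>CC W \<epsilon>"
  shows "(sigma_gYD \<C> c \<pi> V \<tau> W \<epsilon> \<otimes> \<one> U) \<cdot> (\<one> V \<otimes> sigma_gYD \<C> c \<pi> U \<rho> W \<epsilon>)
      \<cdot> (sigma_gYD \<C> c \<pi> U \<rho> V \<delta> \<otimes> \<one> W) =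
    (\<one> W \<otimes> sigma_gYD \<C> c \<pi> U \<rho> V \<delta>) \<cdot> (sigma_gYD \<C> c \<pi> U \<rho> W \<epsilon> \<otimes> \<one> V)
      \<cdot> (\<one> U \<otimes> sigma_gYD \<C> c \<pi> V \<tau> W \<epsilon>)"
proof -
  have \<rho>: "\<rho> \<in> hom \<C> (U \<odot> A) U" and \<epsilon>: "\<epsilon> \<in> hom \<C> W (W \<odot> C)"
    and [simp]: "U \<in> Obj \<C>" "V \<in> Obj \<C>" "W \<in> Obj \<C>"
    and \<rho>_inv: "\<rho> \<cdot> (\<rho> \<otimes> \<one> A) = \<rho> \<cdot> (\<rho> \<otimes> \<one> A) \<cdot> (\<one> U \<otimes> \<sigma>AA)"
    and \<epsilon>_inv: "(\<epsilon> \<otimes> \<one> C) \<cdot> \<epsilon> = (\<one> W \<otimes> \<sigma>CC) \<cdot> (\<epsilon> \<otimes> \<one> C) \<cdot> \<epsilon>"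
    using U V W by (simp_all add: braided_module_def braided_comodule_def)
  note [simp] = arr_of_hom[OF \<rho>] arr_of_hom[OF \<tau>] arr_of_hom[OF \<delta>] arr_of_hom[OF \<epsilon>] arr_of_hom[OF \<pi>]
    arr_of_hom[OF \<sigma>CC] arr_of_hom[OF \<sigma>AA] arr_of_hom[OF \<sigma>CA]
  have o [simp]: "C \<in> Obj \<C>" "A \<in> Obj \<C>"
    using dom_closed[of \<pi>] cod_closed[of \<pi>] by simp_all
  define \<phi> \<psi> where "\<phi> = \<rho> \<cdot> (\<one> U \<otimes> \<pi>)" and "\<psi> = \<tau> \<cdot> (\<one> V \<otimes> \<pi>)"
  have \<phi>: "\<phi> \<in> hom \<C> (U \<odot> C) U" and \<psi>: "\<psi> \<in> hom \<C> (V \<odot> C) V"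
    by (simp_all add: \<phi>_def \<psi>_def hom_def)
  have s: "endo_power \<C> \<sigma>CC n \<in> hom \<C> (C \<odot> C) (C \<odot> C)" "endo_power \<C> \<sigma>AA n \<in> hom \<C> (A \<odot> A) (A \<odot> A)" for n
    using endo_power_hom \<sigma>CC \<sigma>AA by auto
  note [simp] = arr_of_hom[OF s(1)] arr_of_hom[OF s(2)]
  have C_absorb: "(\<one> W \<otimes> endo_power \<C> \<sigma>CC n) \<cdot> (\<epsilon> \<otimes> \<one> C) \<cdot> \<epsilon> = (\<epsilon> \<otimes> \<one> C) \<cdot> \<epsilon>" for n
    by (rule endo_power_absorb_left[OF _ \<sigma>CC _ \<epsilon>_inv, where Z = W]) (simp_all add: hom_def)
  have \<rho>_inv': "\<rho> \<cdot> (\<rho> \<otimes> \<one> A) = (\<rho> \<cdot> (\<rho> \<otimes> \<one> A)) \<cdot> (\<one> U \<otimes> \<sigma>AA)"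
    by (subst \<rho>_inv) simp
  have A_absorb: "(\<rho> \<cdot> (\<rho> \<otimes> \<one> A)) \<cdot> (\<one> U \<otimes> endo_power \<C> \<sigma>AA n) = \<rho> \<cdot> (\<rho> \<otimes> \<one> A)" for n
    by (rule endo_power_absorb_right[OF _ \<sigma>AA _ \<rho>_inv', where Z = U]) (simp_all add: hom_def)
  let ?T = "sandwich C A U \<rho> V \<tau> \<delta>"
  let ?H\<^sub>1 = "(c A A \<otimes> \<pi>) \<cdot> (\<pi> \<otimes> \<sigma>CA) \<cdot> (c C C \<otimes> \<pi>)"
  let ?H\<^sub>2 = "(\<one> A \<otimes> \<pi> \<otimes> \<one> A) \<cdot> (c C A \<otimes> \<pi>) \<cdot> (\<one> C \<otimes> \<pi> \<otimes> \<one> C)"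
  \<comment> \<open>The powers on the \<open>A\<close> side vanish in \<open>U\<close>; those on the \<open>C\<close> side are left for \<open>W\<close> to absorb.\<close>
  have T: "?T ((\<one> A \<otimes> endo_power \<C> \<sigma>AA m) \<cdot> H \<cdot> (\<one> C \<otimes> endo_power \<C> \<sigma>CC n)) =
      ?T H \<cdot> (\<one> U \<otimes> \<one> V \<otimes> endo_power \<C> \<sigma>CC n)" if H: "H \<in> hom \<C> (C \<odot> C \<odot> C) (A \<odot> A \<odot> A)" for H m n
  proof -
    have "H \<cdot> (\<one> C \<otimes> endo_power \<C> \<sigma>CC n) \<in> hom \<C> (C \<odot> C \<odot> C) (A \<odot> A \<odot> A)"
      using arr_of_hom[OF H] by (simp add: hom_def)
    then show ?thesis
      by (simp add: sandwich_absorb_left[OF _ _ _ _ \<rho> \<tau> \<delta> _ s(2) A_absorb] sandwich_precomp[OF _ _ _ _ \<rho> \<tau> \<delta> H s(1)])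
  qed
  have h: "?H\<^sub>1 \<in> hom \<C> (C \<odot> C \<odot> C) (A \<odot> A \<odot> A)" "?H\<^sub>2 \<in> hom \<C> (C \<odot> C \<odot> C) (A \<odot> A \<odot> A)"
    by (simp_all add: hom_def)
  have "?T ?H\<^sub>1 \<cdot> (\<one> U \<otimes> \<one> V \<otimes> endo_power \<C> \<sigma>CC \<gamma>\<^sub>1) = ?T ?H\<^sub>2 \<cdot> (\<one> U \<otimes> \<one> V \<otimes> endo_power \<C> \<sigma>CC \<gamma>\<^sub>2)"
    using coeff T[OF h(1), of \<alpha>\<^sub>1 \<gamma>\<^sub>1] T[OF h(2), of \<alpha>\<^sub>2 \<gamma>\<^sub>2] by simp
  then have "(braiding C U \<phi> V \<delta> \<cdot> diagonal_action C U \<phi> V \<psi>) \<cdot> (\<one> (U \<odot> V) \<otimes> endo_power \<C> \<sigma>CC \<gamma>\<^sub>1) =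
      (diagonal_action C V \<psi> U \<phi> \<cdot> (braiding C U \<phi> V \<delta> \<otimes> \<one> (C \<odot> C))) \<cdot> (\<one> (U \<odot> V) \<otimes> endo_power \<C> \<sigma>CC \<gamma>\<^sub>2)"
    unfolding braiding_after_diagonal_action_sandwich[OF o \<open>U \<in> Obj \<C>\<close> V \<rho> \<tau> \<delta> \<pi> \<sigma>CA \<phi>_def \<psi>_def compat]
      diagonal_action_after_braiding_sandwich[OF o \<open>U \<in> Obj \<C>\<close> V \<rho> \<tau> \<delta> \<pi> \<phi>_def \<psi>_def]
    by (simp only: tensor_id[symmetric] \<open>U \<in> Obj \<C>\<close> V)
  then have "braiding C U \<phi> V \<delta> \<cdot> diagonal_action C U \<phi> V \<psi> \<cdot> (\<one> (U \<odot> V) \<otimes> endo_power \<C> \<sigma>CC \<gamma>\<^sub>1) =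
      diagonal_action C V \<psi> U \<phi> \<cdot> (braiding C U \<phi> V \<delta> \<otimes> \<one> (C \<odot> C)) \<cdot> (\<one> (U \<odot> V) \<otimes> endo_power \<C> \<sigma>CC \<gamma>\<^sub>2)"
    using arr_of_hom[OF braiding_hom[OF _ _ _ \<phi> \<delta>]] arr_of_hom[OF diagonal_action_hom[OF _ _ _ \<phi> \<psi>]]
      arr_of_hom[OF diagonal_action_hom[OF _ _ _ \<psi> \<phi>]] by simp
  from yang_baxter_of_intertwining[OF _ _ _ _ \<phi> \<psi> \<delta> \<epsilon> s(1) s(1) C_absorb C_absorb this]
  show ?thesis
    by (simp add: sigma_gYD_eq_braiding[OF _ _ _ _ \<rho> _ \<pi>] sigma_gYD_eq_braiding[OF _ _ _ _ \<tau> _ \<pi>] \<delta> \<epsilon> \<phi>_def \<psi>_def)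
qed

end

theorem theorem1:
  fixes \<C> :: "('o, 'm, 'z) monoidal_structure_scheme" (structure)
    and c :: "'o \<Rightarrow> 'o \<Rightarrow> 'm"
    and C A :: 'o
    and \<sigma>CC \<sigma>AA \<sigma>CA \<pi> :: 'm
    and \<alpha>\<^sub>1 \<alpha>\<^sub>2 \<gamma>\<^sub>1 \<gamma>\<^sub>2 r :: nat
    and M :: "nat \<Rightarrow> 'o"
    and \<rho> \<delta> :: "nat \<Rightarrow> 'm"
  assumes "symmetric_strict_monoidal_category \<C> c"
    and "braided_system2 \<C> C A \<sigma>CC \<sigma>AA \<sigma>CA"
    and "\<pi> \<in> hom \<C> C A"
    and "(\<one> A \<otimes> endo_power \<C> \<sigma>AA \<alpha>\<^sub>1) \<cdot> (c A A \<otimes> \<pi>) \<cdot> (\<pi> \<otimes> \<sigma>CA) \<cdot> (c C C \<otimes> \<pi>)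
           \<cdot> (\<one> C \<otimes> endo_power \<C> \<sigma>CC \<gamma>\<^sub>1) =
         (\<one> A \<otimes> endo_power \<C> \<sigma>AA \<alpha>\<^sub>2) \<cdot> (\<one> A \<otimes> \<pi> \<otimes> \<one> A) \<cdot> (c C A \<otimes> \<pi>) \<cdot> (\<one> C \<otimes> \<pi> \<otimes> \<one> C)
           \<cdot> (\<one> C \<otimes> endo_power \<C> \<sigma>CC \<gamma>\<^sub>2)"
    and "\<And>i. 1 \<le> i \<Longrightarrow> i \<le> r \<Longrightarrow>
           yetter_drinfeld_module \<C> C A \<sigma>CC \<sigma>AA \<sigma>CA (M i) (\<rho> i) (\<delta> i)"
  shows "braided_system \<C> r M (\<lambda>i j. sigma_gYD \<C> c \<pi> (M i) (\<rho> i) (M j) (\<delta> j))"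
proof -
  interpret symmetric_strict_monoidal_category \<C> c by fact
  have \<sigma>: "(if j = 1 then \<sigma>CC else if i = 1 then \<sigma>CA else \<sigma>AA) \<in>
      hom \<C> ((if i = 1 then C else A) \<odot> (if j = 1 then C else A))
        ((if j = 1 then C else A) \<odot> (if i = 1 then C else A))"
    if "1 \<le> i" "i \<le> j" "j \<le> 2" for i j :: nat
    using assms(2) that unfolding braided_system2_def braided_system_def by blast
  have CC: "\<sigma>CC \<in> hom \<C> (C \<odot> C) (C \<odot> C)" and AA: "\<sigma>AA \<in> hom \<C> (A \<odot> A) (A \<odot> A)"
    and CA: "\<sigma>CA \<in> hom \<C> (C \<odot> A) (A \<odot> C)"
    using \<sigma>[of 1 1] \<sigma>[of 2 2] \<sigma>[of 1 2] by simp_all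
  have YD: "braided_module \<C> A \<sigma>AA (M i) (\<rho> i)" "braided_comodule \<C> C \<sigma>CC (M i) (\<delta> i)"
    "M i \<in> Obj \<C>" "\<rho> i \<in> hom \<C> (M i \<odot> A) (M i)" "\<delta> i \<in> hom \<C> (M i) (M i \<odot> C)"
    "\<delta> i \<cdot> \<rho> i = (\<rho> i \<otimes> \<one> C) \<cdot> (\<one> (M i) \<otimes> \<sigma>CA) \<cdot> (\<delta> i \<otimes> \<one> A)" if "1 \<le> i" "i \<le> r" for i
    using assms(5)[OF that]
    by (simp_all add: yetter_drinfeld_module_def braided_module_def braided_comodule_def)
  show ?thesis
    unfolding braided_system_def
  proof (intro conjI allI impI)
    fix i assume "1 \<le> i \<and> i \<le> r"
    then show "M i \<in> Obj \<C>" using YD(3) by blast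
  next
    fix i j assume "1 \<le> i \<and> i \<le> j \<and> j \<le> r"
    then show "sigma_gYD \<C> c \<pi> (M i) (\<rho> i) (M j) (\<delta> j) \<in> hom \<C> (M i \<odot> M j) (M j \<odot> M i)"
      using YD[of i] YD[of j] assms(3) by (intro sigma_gYD_hom) auto
  next
    fix i j k assume "1 \<le> i \<and> i \<le> j \<and> j \<le> k \<and> k \<le> r"
    then have "1 \<le> i" "i \<le> r" "1 \<le> j" "j \<le> r" "1 \<le> k" "k \<le> r" by auto
    note i = YD[OF this(1,2)] and j = YD[OF this(3,4)] and k = YD[OF this(5,6)]
    show "(sigma_gYD \<C> c \<pi> (M j) (\<rho> j) (M k) (\<delta> k) \<otimes> \<one> (M i)) \<cdot>
        (\<one> (M j) \<otimes> sigma_gYD \<C> c \<pi> (M i) (\<rho> i) (M k) (\<delta> k)) \<cdot>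
        (sigma_gYD \<C> c \<pi> (M i) (\<rho> i) (M j) (\<delta> j) \<otimes> \<one> (M k)) =
      (\<one> (M k) \<otimes> sigma_gYD \<C> c \<pi> (M i) (\<rho> i) (M j) (\<delta> j)) \<cdot>
        (sigma_gYD \<C> c \<pi> (M i) (\<rho> i) (M k) (\<delta> k) \<otimes> \<one> (M j)) \<cdot>
        (\<one> (M i) \<otimes> sigma_gYD \<C> c \<pi> (M j) (\<rho> j) (M k) (\<delta> k))"
      by (rule sigma_gYD_yang_baxter[OF assms(3) CC AA CA assms(4) i(1) j(3,4,5,6) k(2)])
  qed
qed

end
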